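(* For any integer $g\ge 3$, there exists an oriented graph $D$ with maximum degree $\Delta(D)=3$, ${\rm fas}(D)>a(D)/95$ and directed girth at least $g$. In particular, for every $g\ge 3$, ${\rm fas}(3,g)>\frac{1}{95}$ and ${\rm fasd}(3,g)\le 94$.
   Context: An oriented graph is a digraph without loops, multiple arcs or directed $2$-cycles. Degree = in-degree + out-degree; directed girth = minimum length of a directed cycle ($\infty$ if none). ${\rm fas}(D)$ is the minimum size of a feedback arc set (arc set whose removal makes $D$ acyclic), $a(D)=|A(D)|$, and ${\rm fasd}(D)$ is the maximum number of feedback arc sets into which $A(D)$ can be partitioned ($\infty$ if $D$ acyclic). ${\rm fas}(\Delta,g)$ is the supremum of ${\rm fas}(D)/a(D)$ and ${\rm fasd}(\Delta,g)$ the minimum of ${\rm fasd}(D)$, both over oriented graphs $D$ (with at least one arc) of maximum degree at most $\Delta$ and directed girth at least $g$. *)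

theory Defs
  imports Complex_Main "HOL-Library.Extended_Nat" "HOL-Library.Disjoint_Sets"
    "Graph_Theory.Pair_Digraph"
begin

text \<open>
  Arcs are ordered pairs of vertices, so there are no multiple arcs;
  the locale \<^locale>\<open>pair_digraph\<close> provides finiteness and excludes loops.
\<close>

locale oriented_graph = pair_digraph D for D :: "'a pair_pre_digraph" +
  assumes no_2_cycles: "(u, v) \<in> parcs D \<Longrightarrow> (v, u) \<notin> parcs D"

definition degree :: "'a pair_pre_digraph \<Rightarrow> 'a \<Rightarrow> nat" where
  "degree D v = in_degree (with_proj D) v + out_degree (with_proj D) v"

text \<open>Unspecified for the graph without vertices.\<close>

definition max_degree :: "'a pair_pre_digraph \<Rightarrow> nat" where
  "max_degree D = Max (degree D ` pverts D)"

definition directed_cycle :: "'a pair_pre_digraph \<Rightarrow> ('a \<times> 'a) list \<Rightarrow> bool" where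
  "directed_cycle D p \<longleftrightarrow> pre_digraph.cycle (with_proj D) p"

definition acyclic_digraph :: "'a pair_pre_digraph \<Rightarrow> bool" where
  "acyclic_digraph D \<longleftrightarrow> \<not> (\<exists>p. directed_cycle D p)"

text \<open>The infimum of the empty set in \<^typ>\<open>enat\<close> is \<open>\<infinity>\<close>.\<close>

definition directed_girth :: "'a pair_pre_digraph \<Rightarrow> enat" where
  "directed_girth D = (INF p \<in> {p. directed_cycle D p}. enat (length p))"

definition feedback_arc_set :: "'a pair_pre_digraph \<Rightarrow> ('a \<times> 'a) set \<Rightarrow> bool" where
  "feedback_arc_set D F \<longleftrightarrow>
     F \<subseteq> parcs D \<and> acyclic_digraph (D\<lparr>parcs := parcs D - F\<rparr>)"

definition fas :: "'a pair_pre_digraph \<Rightarrow> nat" where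
  "fas D = Min (card ` {F. feedback_arc_set D F})"

definition num_arcs :: "'a pair_pre_digraph \<Rightarrow> nat" where
  "num_arcs D = card (parcs D)"

text \<open>
  If the digraph is not acyclic, every feedback arc set is nonempty, so it makes no
  difference that \<^const>\<open>partition_on\<close> requires nonempty parts.
\<close>

definition fasd :: "'a pair_pre_digraph \<Rightarrow> enat" where
  "fasd D = (if acyclic_digraph D then \<infinity>
     else enat (Max (card ` {P. partition_on (parcs D) P \<and> (\<forall>F\<in>P. feedback_arc_set D F)})))"

text \<open>
  Every finite digraph is isomorphic to one whose vertices are natural numbers.
\<close>

definition bounded_oriented_graphs :: "nat \<Rightarrow> nat \<Rightarrow> nat pair_pre_digraph set" where
  "bounded_oriented_graphs \<Delta> g =
     {D. oriented_graph D \<and> parcs D \<noteq> {} \<and> max_degree D \<le> \<Delta> \<and> directed_girth D \<ge> enat g}"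

definition fas_sup :: "nat \<Rightarrow> nat \<Rightarrow> real" where
  "fas_sup \<Delta> g = (SUP D \<in> bounded_oriented_graphs \<Delta> g. real (fas D) / real (num_arcs D))"

text \<open>
  A nonempty set of extended naturals contains its infimum, so this is a minimum
  (for \<open>\<Delta> \<ge> 1\<close>, where the single arc belongs to the class).
\<close>

definition fasd_min :: "nat \<Rightarrow> nat \<Rightarrow> enat" where
  "fasd_min \<Delta> g = (INF D \<in> bounded_oriented_graphs \<Delta> g. fasd D)"

end

theory Submission
  imports Defs "HOL-Combinatorics.Permutations"
begin

text \<open>
  Splitting every vertex of a digraph with in- and out-degrees at most 2 into an arc turns it into
  a digraph of maximum degree 3 with 3 arcs per original vertex, and turns feedback vertex sets
  into feedback arc sets. So it suffices to find digraphs on \<open>n = 25 t\<close> vertices, with boundedly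
  many directed cycles of length below \<open>g\<close>, in which no \<open>t\<close> vertices meet all directed cycles;
  destroying the short cycles then costs only a bounded number of arcs, and \<open>t\<close> exceeds
  \<open>3 n / 95\<close> by a linear amount.

  Such a digraph is given by a random permutation of \<open>2 n\<close> slots, two at each vertex. The expected
  number of short cycles is bounded independently of \<open>n\<close>. If the removal of \<open>t\<close> vertices left
  an acyclic digraph, then cutting a topological order in the middle would give disjoint sets \<open>A\<close>,
  \<open>B\<close> of \<open>12 t\<close> vertices each without an arc from \<open>B\<close> to \<open>A\<close>; a union bound over \<open>A\<close> and
  \<open>B\<close> shows that this happens with probability at most 1/2.
\<close>

section \<open>Counting permutations\<close>

text \<open>Induction on \<open>xs\<close>: following \<open>s\<close> by the transposition of
  \<open>x\<close> and \<open>s x\<close> fixes \<open>x\<close>, which leaves a permutation of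
  \<open>T - {x}\<close> with prescribed values on the rest. Only a bound, since an inadmissible
  \<open>ys\<close> gives the empty set.\<close>

lemma card_permutes_map_eq_le:
  assumes "finite T" "distinct xs" "set xs \<subseteq> T"
  shows "card {s. s permutes T \<and> map s xs = ys} \<le> fact (card T - length xs)"
  using assms
proof (induction xs arbitrary: T ys)
  case Nil
  have "card {s. s permutes T \<and> map s [] = ys} \<le> card {s. s permutes T}"
    using Nil by (intro card_mono finite_permutations) auto
  then show ?case using Nil by (simp add: card_permutations)
next
  case (Cons x xs)
  show ?case
  proof (cases ys)
    case Nil
    then show ?thesis by simp
  next
    case (Cons y ys')
    define \<tau> where "\<tau> = transpose x y"
    define Q where "Q = {s. s permutes (T - {x}) \<and> map s xs = map \<tau> ys'}"
    have finQ: "finite Q"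
      unfolding Q_def using Cons.prems(1)
      by (intro finite_subset[OF _ finite_permutations[of "T - {x}"]]) auto
    have "(\<lambda>s. \<tau> \<circ> s) ` {s. s permutes T \<and> map s (x # xs) = ys} \<subseteq> Q"
    proof (rule image_subsetI)
      fix s assume "s \<in> {s. s permutes T \<and> map s (x # xs) = ys}"
      then have s: "s permutes T" "map s (x # xs) = ys" by blast+
      have sx: "s x = y" using s(2) Cons by simp
      have "y \<in> T" using s(1) sx Cons.prems(3) permutes_in_image[of s T x] by auto
      then have "\<tau> permutes T"
        unfolding \<tau>_def using Cons.prems(3) by (intro permutes_swap_id) auto
      then have "(\<tau> \<circ> s) permutes T" using s(1) by (rule permutes_compose[rotated])
      moreover have "(\<tau> \<circ> s) x = x" by (simp add: \<tau>_def sx)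
      ultimately have "(\<tau> \<circ> s) permutes (T - {x})"
        using permutes_superset[of "\<tau> \<circ> s" T "T - {x}"] by blast
      moreover have "map (\<tau> \<circ> s) xs = map \<tau> ys'"
        using s(2) Cons by auto
      ultimately show "\<tau> \<circ> s \<in> Q" by (simp add: Q_def)
    qed
    moreover have "inj_on (\<lambda>s. \<tau> \<circ> s) {s. s permutes T \<and> map s (x # xs) = ys}"
      unfolding \<tau>_def by (rule inj_on_subset[OF fun.inj_map[OF inj_transpose]]) simp
    ultimately have "card {s. s permutes T \<and> map s (x # xs) = ys} \<le> card Q"
      using card_inj_on_le finQ by blast
    also have "card Q \<le> fact (card (T - {x}) - length xs)"
      unfolding Q_def using Cons.prems by (intro Cons.IH) auto
    also have "card (T - {x}) - length xs = card T - length (x # xs)"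
      using Cons.prems by simp
    finally show ?thesis .
  qed
qed

text \<open>A union over the injective image lists of \<open>B\<close> in \<open>C\<close>: the
  first two factors count these lists, the last bounds the permutations that realise a given
  list.\<close>

lemma card_permutes_image_subset_le:
  assumes "finite T" "B \<subseteq> T" "C \<subseteq> T" "card B \<le> card C"
  shows "card {s. s permutes T \<and> s ` B \<subseteq> C}
    \<le> (card C choose card B) * fact (card B) * fact (card T - card B)"
proof -
  have fin: "finite B" "finite C" using assms finite_subset by blast+
  obtain xs where xs: "set xs = B" "distinct xs" using fin finite_distinct_list by blast
  have len: "length xs = card B" using xs distinct_card by fastforce
  define L where "L = {ys. length ys = card B \<and> distinct ys \<and> set ys \<subseteq> C}"
  have finL: "finite L"
    unfolding L_def by (rule finite_subset[OF _ finite_lists_length_eq[OF fin(2), of "card B"]]) auto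
  have "{s. s permutes T \<and> s ` B \<subseteq> C} \<subseteq> (\<Union>ys\<in>L. {s. s permutes T \<and> map s xs = ys})"
  proof safe
    fix s assume s: "s permutes T" "s ` B \<subseteq> C"
    then have "map s xs \<in> L"
      using xs len by (auto simp: L_def distinct_map intro: inj_on_subset[OF permutes_inj])
    then show "s \<in> (\<Union>ys\<in>L. {s. s permutes T \<and> map s xs = ys})" using s by auto
  qed
  then have "card {s. s permutes T \<and> s ` B \<subseteq> C}
      \<le> card (\<Union>ys\<in>L. {s. s permutes T \<and> map s xs = ys})"
    using finL assms(1)
    by (intro card_mono finite_UN_I) (auto intro: finite_subset[OF _ finite_permutations])
  also have "\<dots> \<le> (\<Sum>ys\<in>L. card {s. s permutes T \<and> map s xs = ys})"
    by (rule card_UN_le[OF finL])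
  also have "\<dots> \<le> (\<Sum>ys\<in>L. fact (card T - card B))"
    using card_permutes_map_eq_le[OF assms(1) xs(2)] xs(1) assms(2) len
    by (intro sum_mono) auto
  also have "\<dots> = card L * fact (card T - card B)" by simp
  also have "card L = (card C choose card B) * fact (card B)"
  proof -
    \<comment> \<open>The falling factorial becomes a binomial coefficient times a factorial after
      both are multiplied by \<open>fact (card C - card B)\<close>.\<close>
    have "card L = \<Prod>{card C - card B + 1 .. card C}"
      unfolding L_def using fin assms(4) by (intro card_lists_distinct_length_eq) auto
    moreover have "\<Prod>{card C - card B + 1 .. card C} * fact (card C - card B) = (fact (card C) :: nat)"
      using fact_div_fact[of "card C - card B" "card C"] fact_dvd[of "card C - card B" "card C"]
      by (metis diff_le_self dvd_div_mult_self)
    moreover have "fact (card B) * fact (card C - card B) * (card C choose card B) = (fact (card C)::nat)"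
      by (rule binomial_fact_lemma[OF assms(4)])
    ultimately have "card L * fact (card C - card B)
        = ((card C choose card B) * fact (card B)) * fact (card C - card B)"
      by (simp add: ac_simps)
    then show ?thesis by simp
  qed
  finally show ?thesis .
qed

section \<open>Binomial estimates for the union bound\<close>

lemma binomial_mult_le:
  "(m choose k) * (n choose l) \<le> (m + n) choose (k + l)"
proof -
  have "(m choose k) * (n choose (k + l - k)) \<le> (\<Sum>i\<le>k+l. (m choose i) * (n choose (k + l - i)))"
    by (intro member_le_sum) auto
  then show ?thesis by (simp add: vandermonde)
qed

lemma binomial_power_le: "(m choose k) ^ t \<le> (m * t) choose (k * t)"
proof (induction t)
  case (Suc t)
  have "(m choose k) ^ Suc t \<le> (m choose k) * ((m * t) choose (k * t))"
    using Suc by simp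
  also have "\<dots> \<le> (m * Suc t) choose (k * Suc t)"
    using binomial_mult_le[of m k "m * t" "k * t"] by simp
  finally show ?case .
qed simp

text \<open>One term of the expansion of \<open>(1 + 12) ^ (13 * t)\<close> is at most the whole
  sum. The weight 12 makes the term at \<open>t\<close> the largest one, and 34 is just above
  \<open>13 ^ 13 / 12 ^ 12\<close>.\<close>

lemma binomial_13_le: "(13 * t) choose t \<le> 34 ^ t"
proof -
  have "((13 * t) choose t) * 12 ^ (13 * t - t) \<le> (\<Sum>k\<le>13*t. ((13 * t) choose k) * 1 ^ k * 12 ^ (13 * t - k))"
    using member_le_sum[of t "{..13*t}" "\<lambda>k. ((13 * t) choose k) * 1 ^ k * 12 ^ (13 * t - k)"] by simp
  also have "\<dots> = (1 + 12) ^ (13 * t)" by (subst binomial) simp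
  also have "\<dots> = (13 ^ 13) ^ t" by (simp add: power_mult)
  also have "\<dots> \<le> (34 * 12 ^ 12 :: nat) ^ t" by (intro power_mono) auto
  also have "\<dots> = 34 ^ t * 12 ^ (12 * t)" by (simp only: power_mult_distrib power_mult)
  finally show ?thesis by simp
qed

text \<open>The first two binomials count the pairs \<open>A\<close>, \<open>B\<close>; the third
  over the right-hand side is the probability bound for one pair. Since the right-hand side is at
  least the square of \<open>25 * t choose 12 * t\<close>, one copy of that factor cancels.\<close>

lemma two_binomial_product_le:
  assumes "t > 0"
  shows "2 * ((25 * t choose 12 * t) * (13 * t choose 12 * t) * (26 * t choose 24 * t))
    \<le> 50 * t choose 24 * t"
proof -
  have 1: "13 * t choose 12 * t \<le> 34 ^ t"
    using binomial_13_le[of t] binomial_symmetric[of "12 * t" "13 * t"] by simp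
  have 2: "26 * t choose 24 * t \<le> 34 ^ (2 * t)"
    using binomial_13_le[of "2 * t"] binomial_symmetric[of "24 * t" "26 * t"] by simp
  have 3: "(5200300::nat) ^ t \<le> 25 * t choose 12 * t"
  proof -
    have "(25 choose 12 :: nat) = 5200300" 
      using binomial_fact_lemma[of 12 25] by (simp add: fact_numeral)
    then show ?thesis using binomial_power_le[of 25 12 t] by simp
  qed
  \<comment> \<open>The leading 2 is absorbed into \<open>2 ^ t\<close>, which needs
    \<open>t > 0\<close>; per unit of \<open>t\<close> it remains to compare
    \<open>2 * 34 ^ 3 = 78608\<close> with 5200300.\<close>
  have "2 * ((13 * t choose 12 * t) * (26 * t choose 24 * t)) \<le> 2 ^ t * (34 ^ t * 34 ^ (2 * t))"
    using 1 2 assms by (intro mult_mono self_le_power) auto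
  also have "\<dots> = (2 * 34 * 34 ^ 2) ^ t" by (simp only: power_mult_distrib power_mult mult.assoc)
  also have "\<dots> \<le> 5200300 ^ t" by (intro power_mono) auto
  also note 3
  finally have "(25 * t choose 12 * t) * (2 * ((13 * t choose 12 * t) * (26 * t choose 24 * t)))
      \<le> (25 * t choose 12 * t) * (25 * t choose 12 * t)" by simp
  also have "\<dots> \<le> 50 * t choose 24 * t"
    using binomial_mult_le[of "25 * t" "12 * t" "25 * t" "12 * t"] by simp
  finally show ?thesis by (simp add: ac_simps)
qed

section \<open>Random slot digraphs\<close>

lemma div2_vimage_eq: "{x::nat. x div 2 \<in> P} = (\<lambda>v. 2 * v) ` P \<union> (\<lambda>v. 2 * v + 1) ` P"
proof (intro equalityI subsetI)
  fix x :: nat assume x: "x \<in> {x. x div 2 \<in> P}"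
  have "x = 2 * (x div 2) \<or> x = 2 * (x div 2) + 1" by presburger
  with x show "x \<in> (\<lambda>v. 2 * v) ` P \<union> (\<lambda>v. 2 * v + 1) ` P" by blast
qed auto

lemma card_div2_vimage:
  assumes "finite P"
  shows "card {x::nat. x div 2 \<in> P} = 2 * card P"
proof -
  have "card {x::nat. x div 2 \<in> P} = card ((\<lambda>v. 2 * v) ` P) + card ((\<lambda>v. 2 * v + 1) ` P)"
    unfolding div2_vimage_eq using assms by (intro card_Un_disjoint) (auto, presburger)
  also have "\<dots> = 2 * card P" by (simp add: card_image inj_on_def)
  finally show ?thesis .
qed

lemma card_disjoint_subset_pairs:
  assumes "finite V"
  shows "card (SIGMA A:{A. A \<subseteq> V \<and> card A = a}. {B. B \<subseteq> V - A \<and> card B = b})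
    = (card V choose a) * (card V - a choose b)"
proof -
  have "card (SIGMA A:{A. A \<subseteq> V \<and> card A = a}. {B. B \<subseteq> V - A \<and> card B = b})
      = (\<Sum>A\<in>{A. A \<subseteq> V \<and> card A = a}. card {B. B \<subseteq> V - A \<and> card B = b})"
    using assms by (intro card_SigmaI) auto
  also have "\<dots> = (\<Sum>A\<in>{A. A \<subseteq> V \<and> card A = a}. (card V - a choose b))"
  proof (intro sum.cong refl)
    fix A assume "A \<in> {A. A \<subseteq> V \<and> card A = a}"
    then have "card (V - A) = card V - a"
      using assms by (auto simp: card_Diff_subset finite_subset)
    then show "card {B. B \<subseteq> V - A \<and> card B = b} = (card V - a choose b)"
      using n_subsets[of "V - A" b] assms by simp
  qed
  also have "\<dots> = (card V choose a) * (card V - a choose b)"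
    using n_subsets[OF assms, of a] by simp
  finally show ?thesis .
qed

text \<open>
  Vertex \<open>v\<close> owns the slots \<open>2 v\<close> and \<open>2 v + 1\<close>; a permutation \<open>s\<close> of the slots puts an arc
  from \<open>x div 2\<close> to \<open>s x div 2\<close> for every slot \<open>x\<close>.
\<close>

definition no_slot_arcs :: "(nat \<Rightarrow> nat) \<Rightarrow> nat set \<Rightarrow> nat set \<Rightarrow> bool" where
  "no_slot_arcs s B A \<longleftrightarrow> (\<forall>x. x div 2 \<in> B \<longrightarrow> s x div 2 \<notin> A)"

definition splittable :: "nat \<Rightarrow> (nat \<Rightarrow> nat) \<Rightarrow> bool" where
  "splittable t s \<longleftrightarrow> (\<exists>A B. A \<subseteq> {..<25 * t} \<and> B \<subseteq> {..<25 * t} - A \<and>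
     card A = 12 * t \<and> card B = 12 * t \<and> no_slot_arcs s B A)"

text \<open>The \<open>24 * t\<close> slots of \<open>B\<close> must be sent into the
  \<open>26 * t\<close> slots that do not belong to \<open>A\<close>.\<close>

lemma card_no_slot_arcs_le:
  assumes "A \<subseteq> {..<25 * t}" "B \<subseteq> {..<25 * t} - A" "card A = 12 * t" "card B = 12 * t"
  shows "card {s. s permutes {..<50 * t} \<and> no_slot_arcs s B A}
    \<le> (26 * t choose 24 * t) * fact (24 * t) * fact (26 * t)"
proof -
  let ?T = "{..<50 * t}"
  define A' where "A' = {x::nat. x div 2 \<in> A}"
  define B' where "B' = {x::nat. x div 2 \<in> B}"
  have fin: "finite A" "finite B" using assms(1,2) by (auto intro: finite_subset)
  have T: "{x. x div 2 \<in> {..<25 * t}} = ?T" by auto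
  have sub: "A' \<subseteq> ?T" "B' \<subseteq> ?T" using assms(1,2) T unfolding A'_def B'_def by blast+
  have cB: "card B' = 24 * t" and cA: "card A' = 24 * t"
    using card_div2_vimage fin assms(3,4) by (simp_all add: A'_def B'_def)
  have finA: "finite A'" using sub(1) finite_subset by blast
  have cC: "card (?T - A') = 26 * t" using sub finA cA by (simp add: card_Diff_subset)
  have "{s. s permutes ?T \<and> no_slot_arcs s B A} \<subseteq> {s. s permutes ?T \<and> s ` B' \<subseteq> ?T - A'}"
  proof (rule subsetI, rule CollectI, rule conjI)
    fix s assume "s \<in> {s. s permutes ?T \<and> no_slot_arcs s B A}"
    then have s: "s permutes ?T" "no_slot_arcs s B A" by blast+
    show "s permutes ?T" by (rule s)
    show "s ` B' \<subseteq> ?T - A'"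
    proof (rule image_subsetI)
      fix x assume x: "x \<in> B'"
      then have "s x \<in> ?T" using sub(2) permutes_in_image[OF s(1)] by blast
      then show "s x \<in> ?T - A'"
        using s(2) x unfolding no_slot_arcs_def A'_def B'_def by blast
    qed
  qed
  then have "card {s. s permutes ?T \<and> no_slot_arcs s B A}
      \<le> card {s. s permutes ?T \<and> s ` B' \<subseteq> ?T - A'}"
    by (intro card_mono finite_subset[OF _ finite_permutations[of ?T]]) auto
  also have "\<dots> \<le> (26 * t choose 24 * t) * fact (24 * t) * fact (26 * t)"
    using card_permutes_image_subset_le[of ?T B' "?T - A'"] sub(2) by (simp add: cB cC)
  finally show ?thesis .
qed

text \<open>Union bound over all pairs \<open>A\<close>, \<open>B\<close>; the product
  \<open>fact (24 * t) * fact (26 * t)\<close> times \<open>50 * t choose 24 * t\<close> is the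
  number of all permutations.\<close>

lemma card_splittable_le:
  assumes "t > 0"
  shows "2 * card {s. s permutes {..<50 * t} \<and> splittable t s} \<le> fact (50 * t)"
proof -
  let ?T = "{..<50 * t}"
  define P where "P = (SIGMA A:{A. A \<subseteq> {..<25 * t} \<and> card A = 12 * t}.
    {B. B \<subseteq> {..<25 * t} - A \<and> card B = 12 * t})"
  have finP: "finite P" unfolding P_def by (intro finite_SigmaI) auto
  have cP: "card P = (25 * t choose 12 * t) * (13 * t choose 12 * t)"
    unfolding P_def by (subst card_disjoint_subset_pairs) auto
  have "{s. s permutes ?T \<and> splittable t s}
      \<subseteq> (\<Union>(A, B)\<in>P. {s. s permutes ?T \<and> no_slot_arcs s B A})"
    unfolding splittable_def P_def by blast
  then have "card {s. s permutes ?T \<and> splittable t s}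
      \<le> card (\<Union>(A, B)\<in>P. {s. s permutes ?T \<and> no_slot_arcs s B A})"
    by (intro card_mono finite_subset[OF _ finite_permutations[of ?T]]) auto
  also have "\<dots> \<le> (\<Sum>p\<in>P. card (case p of (A, B) \<Rightarrow> {s. s permutes ?T \<and> no_slot_arcs s B A}))"
    by (rule card_UN_le[OF finP])
  also have "\<dots> \<le> (\<Sum>p\<in>P. (26 * t choose 24 * t) * fact (24 * t) * fact (26 * t))"
    by (intro sum_mono) (auto simp: P_def intro!: card_no_slot_arcs_le)
  also have "\<dots> = (25 * t choose 12 * t) * (13 * t choose 12 * t) * (26 * t choose 24 * t)
      * (fact (24 * t) * fact (26 * t))"
    by (simp add: cP)
  finally have "2 * card {s. s permutes ?T \<and> splittable t s}
      \<le> 2 * ((25 * t choose 12 * t) * (13 * t choose 12 * t) * (26 * t choose 24 * t))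
        * (fact (24 * t) * fact (26 * t))"
    by simp
  also have "\<dots> \<le> (50 * t choose 24 * t) * (fact (24 * t) * fact (26 * t))"
    using two_binomial_product_le[OF assms] by (rule mult_right_mono) simp
  also have "\<dots> = fact (50 * t)"
    using binomial_fact_lemma[of "24 * t" "50 * t"] by (simp add: ac_simps)
  finally show ?thesis .
qed

section \<open>Expected number of short cycles\<close>

text \<open>The empty list also counts as a slot cycle; this is harmless.\<close>

definition slot_cycle :: "(nat \<Rightarrow> nat) \<Rightarrow> nat list \<Rightarrow> bool" where
  "slot_cycle s xs \<longleftrightarrow> distinct xs \<and>
     map (\<lambda>x. s x div 2) xs = rotate1 (map (\<lambda>x. x div 2) xs)"

lemma finite_card_map_div2_eq:
  "finite {ys::nat list. map (\<lambda>x. x div 2) ys = zs} \<and>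
   card {ys::nat list. map (\<lambda>x. x div 2) ys = zs} \<le> 2 ^ length zs"
proof (induction zs)
  case (Cons z zs)
  let ?L = "{ys::nat list. map (\<lambda>x. x div 2) ys = zs}"
  have "{ys::nat list. map (\<lambda>x. x div 2) ys = z # zs}
      \<subseteq> (\<lambda>(y, ys). y # ys) ` ({2 * z, 2 * z + 1} \<times> ?L)" (is "?M \<subseteq> ?R")
  proof
    fix l :: "nat list" assume "l \<in> ?M"
    then obtain y ys where l: "l = y # ys" "y div 2 = z" "ys \<in> ?L"
      by (cases l) auto
    have "y = 2 * z \<or> y = 2 * z + 1" using l(2) by presburger
    then show "l \<in> ?R" using l by auto
  qed
  moreover have fin: "finite ({2 * z, 2 * z + 1} \<times> ?L)" using Cons by simp
  ultimately have "finite ?M" "card ?M \<le> card ({2 * z, 2 * z + 1} \<times> ?L)"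
    by (auto intro: finite_subset surj_card_le)
  then show ?case using Cons by (simp add: card_cartesian_product)
qed simp

text \<open>The image of each slot of \<open>xs\<close> is known only up to its vertex, hence up to
  two slots. This leaves \<open>2 ^ length xs\<close> image lists, each fixing \<open>s\<close> on
  \<open>xs\<close>.\<close>

lemma card_slot_cycle_le:
  assumes "finite T" "set xs \<subseteq> T"
  shows "card {s. s permutes T \<and> slot_cycle s xs} \<le> 2 ^ length xs * fact (card T - length xs)"
proof (cases "distinct xs")
  case True
  define Y where "Y = {ys. map (\<lambda>x. x div 2) ys = rotate1 (map (\<lambda>x. x div 2) xs)}"
  have Y: "finite Y" "card Y \<le> 2 ^ length xs"
    using finite_card_map_div2_eq[of "rotate1 (map (\<lambda>x. x div 2) xs)"] by (simp_all add: Y_def)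
  have "{s. s permutes T \<and> slot_cycle s xs} \<subseteq> (\<Union>ys\<in>Y. {s. s permutes T \<and> map s xs = ys})"
    by (auto simp: slot_cycle_def Y_def comp_def)
  then have "card {s. s permutes T \<and> slot_cycle s xs}
      \<le> card (\<Union>ys\<in>Y. {s. s permutes T \<and> map s xs = ys})"
    using assms(1) by (intro card_mono finite_subset[OF _ finite_permutations[of T]]) auto
  also have "\<dots> \<le> (\<Sum>ys\<in>Y. card {s. s permutes T \<and> map s xs = ys})"
    by (rule card_UN_le[OF Y(1)])
  also have "\<dots> \<le> (\<Sum>ys\<in>Y. fact (card T - length xs))"
    using card_permutes_map_eq_le[OF assms(1) True assms(2)] by (intro sum_mono) auto
  also have "\<dots> \<le> 2 ^ length xs * fact (card T - length xs)"
    using Y(2) by simp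
  finally show ?thesis .
qed (simp add: slot_cycle_def)

text \<open>Each of the \<open>l\<close> largest factors of \<open>fact N\<close> is at least
  \<open>N / 2\<close>.\<close>

lemma power_mult_fact_diff_le:
  assumes "2 * l \<le> N"
  shows "N ^ l * fact (N - l) \<le> 2 ^ l * (fact N :: nat)"
  using assms
proof (induction l)
  case (Suc l)
  have "N ^ Suc l * fact (N - Suc l) = N ^ l * (N * fact (N - Suc l))" by simp
  also have "\<dots> \<le> N ^ l * (2 * (N - l) * fact (N - Suc l))"
    using Suc.prems by (intro mult_left_mono mult_right_mono) auto
  also have "\<dots> = 2 * (N ^ l * fact (N - l))"
    using Suc.prems fact_reduce[of "N - l", where ?'a = nat] by (simp add: ac_simps)
  also have "\<dots> \<le> 2 * (2 ^ l * fact N)" using Suc by (intro mult_left_mono Suc.IH) auto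
  finally show ?case by simp
qed simp

definition short_slot_cycles :: "nat \<Rightarrow> nat set \<Rightarrow> (nat \<Rightarrow> nat) \<Rightarrow> nat list set" where
  "short_slot_cycles g T s = {xs. set xs \<subseteq> T \<and> length xs < g \<and> slot_cycle s xs}"

lemma lists_length_less_eq:
  "{xs. set xs \<subseteq> T \<and> length xs < g} = (\<Union>l<g. {xs. set xs \<subseteq> T \<and> length xs = l})"
  by auto

lemma finite_short_slot_cycles:
  "finite T \<Longrightarrow> finite (short_slot_cycles g T s)"
  by (rule finite_subset[of _ "{xs. set xs \<subseteq> T \<and> length xs < g}"])
     (auto simp: short_slot_cycles_def lists_length_less_eq finite_lists_length_eq)

text \<open>Double counting of pairs of a permutation and a list. The number of lists of length
  \<open>l\<close> is cancelled by the falling factorial at the cost of \<open>2 ^ l\<close>; with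
  the \<open>2 ^ l\<close> image lists this gives \<open>4 ^ l\<close>, independent of
  \<open>card T\<close>.\<close>

lemma sum_card_short_slot_cycles_le:
  assumes "finite T" "2 * g \<le> card T"
  shows "(\<Sum>s | s permutes T. card (short_slot_cycles g T s)) \<le> (\<Sum>l<g. 4 ^ l) * fact (card T)"
proof -
  let ?L = "{xs. set xs \<subseteq> T \<and> length xs < g}"
  let ?N = "card T"
  have finL: "finite ?L" using assms(1) by (simp add: lists_length_less_eq finite_lists_length_eq)
  have finP: "finite {s. s permutes T}" using assms(1) by (rule finite_permutations)
  have "(\<Sum>s | s permutes T. card (short_slot_cycles g T s))
      = (\<Sum>s | s permutes T. \<Sum>xs\<in>?L. if slot_cycle s xs then 1 else 0)"
  proof (rule sum.cong[OF refl])
    fix s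
    have "short_slot_cycles g T s = {xs \<in> ?L. slot_cycle s xs}"
      by (auto simp: short_slot_cycles_def)
    then show "card (short_slot_cycles g T s) = (\<Sum>xs\<in>?L. if slot_cycle s xs then 1 else 0)"
      using finL by (simp add: sum.If_cases Int_def)
  qed
  also have "\<dots> = (\<Sum>xs\<in>?L. \<Sum>s | s permutes T. if slot_cycle s xs then 1 else 0)"
    by (rule sum.swap)
  also have "\<dots> = (\<Sum>xs\<in>?L. card {s. s permutes T \<and> slot_cycle s xs})"
    using finP by (simp add: sum.If_cases Int_def)
  also have "\<dots> \<le> (\<Sum>xs\<in>?L. 2 ^ length xs * fact (?N - length xs))"
    using assms(1) by (intro sum_mono card_slot_cycle_le) auto
  also have "\<dots> = (\<Sum>l<g. \<Sum>xs\<in>{xs. set xs \<subseteq> T \<and> length xs = l}. 2 ^ length xs * fact (?N - length xs))"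
    unfolding lists_length_less_eq
    by (rule sum.UNION_disjoint) (use assms(1) in \<open>auto simp: finite_lists_length_eq\<close>)
  also have "\<dots> = (\<Sum>l<g. 2 ^ l * (?N ^ l * fact (?N - l)))"
  proof (rule sum.cong[OF refl])
    fix l
    have "(\<Sum>xs\<in>{xs. set xs \<subseteq> T \<and> length xs = l}. 2 ^ length xs * fact (?N - length xs))
        = (\<Sum>xs\<in>{xs. set xs \<subseteq> T \<and> length xs = l}. 2 ^ l * fact (?N - l))"
      by (rule sum.cong) auto
    then show "(\<Sum>xs\<in>{xs. set xs \<subseteq> T \<and> length xs = l}. 2 ^ length xs * fact (?N - length xs))
        = 2 ^ l * (?N ^ l * fact (?N - l))"
      using card_lists_length_eq[OF assms(1), of l] by simp
  qed
  also have "\<dots> \<le> (\<Sum>l<g. 2 ^ l * (2 ^ l * fact ?N))"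
    using assms(2) by (intro sum_mono mult_left_mono power_mult_fact_diff_le) auto
  also have "\<dots> = (\<Sum>l<g. 4 ^ l) * fact ?N"
    by (simp add: sum_distrib_right power_mult_distrib[symmetric] flip: mult.assoc)
  finally show ?thesis .
qed

text \<open>Markov's inequality: at least half of the permutations are unsplittable, so if each of
  these had more than twice the average bound of short cycles, the total would be exceeded.\<close>

lemma exists_unsplittable_few_short_cycles:
  assumes "t > 0" "g \<le> 25 * t"
  obtains s where "s permutes {..<50 * t}" "\<not> splittable t s"
    "card (short_slot_cycles g {..<50 * t} s) \<le> 2 * (\<Sum>l<g. 4 ^ l)"
proof (rule ccontr)
  assume no: "\<not> thesis"
  let ?T = "{..<50 * t}"
  define C :: nat where "C = (\<Sum>l<g. 4 ^ l)"
  define P where "P = {s. s permutes ?T}"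
  define Q where "Q = {s \<in> P. \<not> splittable t s}"
  have fin: "finite P" by (simp add: P_def finite_permutations)
  have cP: "card P = fact (50 * t)" by (simp add: P_def card_permutations[where n = "50 * t"])
  have "card Q = card P - card {s \<in> P. splittable t s}"
    unfolding Q_def by (subst card_Diff_subset[symmetric]) (use fin in \<open>auto intro!: arg_cong[where f = card]\<close>)
  then have Q: "fact (50 * t) \<le> 2 * card Q"
    using card_splittable_le[OF assms(1)] cP by (simp add: P_def)
  have "card Q * (2 * C + 1) = (\<Sum>s\<in>Q. 2 * C + 1)" by simp
  also have "\<dots> \<le> (\<Sum>s\<in>Q. card (short_slot_cycles g ?T s))"
  proof (rule sum_mono)
    fix s assume "s \<in> Q"
    then show "2 * C + 1 \<le> card (short_slot_cycles g ?T s)"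
      using no that[of s] by (force simp: Q_def P_def C_def)
  qed
  also have "\<dots> \<le> (\<Sum>s\<in>P. card (short_slot_cycles g ?T s))"
    using fin by (intro sum_mono2) (auto simp: Q_def)
  also have "\<dots> \<le> C * fact (50 * t)"
    using sum_card_short_slot_cycles_le[of ?T g] assms(2) by (simp add: P_def C_def)
  finally have "2 * card Q * (2 * C + 1) \<le> 2 * C * fact (50 * t)" by simp
  moreover have "fact (50 * t) * (2 * C + 1) \<le> 2 * card Q * (2 * C + 1)"
    using Q by (rule mult_right_mono) simp
  ultimately have "fact (50 * t) * (2 * C + 1) \<le> 2 * C * (fact (50 * t) :: nat)" by linarith
  then show False by (simp add: algebra_simps)
qed

section \<open>Feedback arc sets and girth\<close>

lemma pcas_relpow: "pcas u p v \<Longrightarrow> set p \<subseteq> r \<Longrightarrow> (u, v) \<in> r ^^ length p"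
proof (induction p arbitrary: u)
  case (Cons e p)
  then have "(u, snd e) \<in> r" "(snd e, v) \<in> r ^^ length p" by auto
  then show ?case using relpow_Suc_I2 by fastforce
qed simp

lemma directed_cycle_relpow:
  assumes "directed_cycle D p"
  obtains u where "(u, u) \<in> parcs D ^^ length p" "p \<noteq> []"
proof -
  obtain u where "pcas u p u" "set p \<subseteq> parcs D" "p \<noteq> []"
    using assms
    by (auto simp: directed_cycle_def pre_digraph.cycle_def pre_digraph.awalk_def cas_with_proj_eq)
  then show ?thesis using that pcas_relpow by metis
qed

text \<open>A directed cycle is in particular a closed walk, so girth can be handled through
  relation powers.\<close>

lemma directed_girth_ge:
  assumes "\<And>u k. 0 < k \<Longrightarrow> k < g \<Longrightarrow> (u, u) \<notin> parcs D ^^ k"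
  shows "directed_girth D \<ge> enat g"
  unfolding directed_girth_def
proof (rule INF_greatest)
  fix p assume "p \<in> {p. directed_cycle D p}"
  then obtain u where "(u, u) \<in> parcs D ^^ length p" "p \<noteq> []"
    using directed_cycle_relpow by blast
  then show "enat g \<le> enat (length p)" using assms[of "length p" u] by force
qed

text \<open>Passes from cycles as arc lists to the transitive closure: a nonempty closed walk
  contains a cycle.\<close>

lemma acyclic_parcs:
  assumes "pair_wf_digraph D" "acyclic_digraph D"
  shows "acyclic (parcs D)"
proof -
  interpret pair_wf_digraph D by fact
  show ?thesis
  proof (rule acyclicI, intro allI notI)
    fix u assume "(u, u) \<in> (parcs D)\<^sup>+"
    then obtain p where "awalk u p u" "p \<noteq> []"
      using reachable1_awalk[of u u] by auto
    then have "closed_w p" by (auto simp: closed_w_def)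
    then show False
      using closed_w_imp_cycle assms(2) by (auto simp: acyclic_digraph_def directed_cycle_def)
  qed
qed

lemma acyclic_digraph_no_arcs: "parcs D = {} \<Longrightarrow> acyclic_digraph D"
  by (auto simp: acyclic_digraph_def directed_cycle_def pre_digraph.cycle_def pre_digraph.awalk_def)

lemma feedback_arc_set_parcs: "feedback_arc_set D (parcs D)"
  by (simp add: feedback_arc_set_def acyclic_digraph_no_arcs)

lemma finite_feedback_arc_sets: "finite (parcs D) \<Longrightarrow> finite {F. feedback_arc_set D F}"
  by (rule finite_subset[of _ "Pow (parcs D)"]) (auto simp: feedback_arc_set_def)

lemma fas_le:
  assumes "finite (parcs D)" "feedback_arc_set D F"
  shows "fas D \<le> card F"
  using assms finite_feedback_arc_sets unfolding fas_def by (intro Min_le) auto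

lemma fas_attained:
  assumes "finite (parcs D)"
  obtains F where "feedback_arc_set D F" "card F = fas D"
proof -
  have "fas D \<in> card ` {F. feedback_arc_set D F}"
    unfolding fas_def using finite_feedback_arc_sets[OF assms] feedback_arc_set_parcs
    by (intro Min_in) auto
  then show ?thesis using that by auto
qed

lemma fas_le_num_arcs: "finite (parcs D) \<Longrightarrow> fas D \<le> num_arcs D"
  unfolding num_arcs_def by (rule fas_le[OF _ feedback_arc_set_parcs])

text \<open>The parts are disjoint and each has at least \<open>fas D\<close> arcs.\<close>

lemma card_feedback_partition_mult_fas_le:
  assumes "finite (parcs D)" "partition_on (parcs D) P" "\<And>F. F \<in> P \<Longrightarrow> feedback_arc_set D F"
  shows "card P * fas D \<le> num_arcs D"
proof -
  have "card P * fas D = (\<Sum>F\<in>P. fas D)" by simp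
  also have "\<dots> \<le> (\<Sum>F\<in>P. card F)" using fas_le assms by (intro sum_mono) auto
  also have "\<dots> = num_arcs D"
    using assms(1,2) by (simp add: num_arcs_def card_Union_disjoint[symmetric] partition_on_def disjoint_def
      disjnt_def pairwise_def finite_subset[OF Union_upper])
  finally show ?thesis .
qed

lemma fasd_le:
  assumes "finite (parcs D)" "num_arcs D < Suc k * fas D"
  shows "fasd D \<le> enat k"
proof -
  let ?\<P> = "{P. partition_on (parcs D) P \<and> (\<forall>F\<in>P. feedback_arc_set D F)}"
  \<comment> \<open>An acyclic \<open>D\<close> would have \<open>fas D = 0\<close>, against the
    strict inequality; this excludes the value infinity of \<open>fasd\<close>.\<close>
  have "\<not> acyclic_digraph D"
  proof
    assume "acyclic_digraph D"
    then have "feedback_arc_set D {}" by (simp add: feedback_arc_set_def)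
    then show False using fas_le[OF assms(1)] assms(2) by fastforce
  qed
  moreover have "Max (card ` ?\<P>) \<le> k"
  proof (rule Max.boundedI)
    have "?\<P> \<subseteq> Pow (Pow (parcs D))" by (auto simp: partition_on_def)
    then show "finite (card ` ?\<P>)" using assms(1) by (meson finite_Pow_iff finite_imageI finite_subset)
    \<comment> \<open>The partition into a single part shows that the maximum is taken over a
      nonempty set.\<close>
    have "parcs D \<noteq> {}" using assms fas_le_num_arcs[of D] by (auto simp: num_arcs_def)
    then have "{parcs D} \<in> ?\<P>" by (auto simp: partition_on_def feedback_arc_set_parcs)
    then show "card ` ?\<P> \<noteq> {}" by blast
    fix c assume "c \<in> card ` ?\<P>"
    then obtain P where P: "P \<in> ?\<P>" "c = card P" by blast
    then have "card P * fas D \<le> num_arcs D"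
      using assms(1) by (intro card_feedback_partition_mult_fas_le) auto
    then have "c * fas D < Suc k * fas D" using assms(2) P(2) le_less_trans by blast
    then show "c \<le> k" by (metis less_Suc_eq_le mult_less_cancel2)
  qed
  ultimately show ?thesis by (simp add: fasd_def)
qed

section \<open>Splitting vertices\<close>

text \<open>
  Vertex \<open>v\<close> becomes the arc from \<open>2 v\<close> to \<open>2 v + 1\<close>, deleted for \<open>v \<in> X\<close>. The star centred at
  \<open>2 n\<close> is only there to make the maximum degree exactly 3.
\<close>

definition split_digraph :: "nat \<Rightarrow> nat rel \<Rightarrow> nat set \<Rightarrow> nat pair_pre_digraph" where
  "split_digraph n E X = \<lparr>pverts = {..<2 * n + 4},
     parcs = {(2 * v, 2 * v + 1) | v. v < n \<and> v \<notin> X} \<union> {(2 * v + 1, 2 * w) | v w. (v, w) \<in> E}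
       \<union> {(2 * n, 2 * n + i) | i. i \<in> {1, 2, 3}}\<rparr>"

lemma split_digraph_arcE:
  assumes "(a, b) \<in> parcs (split_digraph n E X)"
  obtains (vertex) v where "a = 2 * v" "b = 2 * v + 1" "v < n" "v \<notin> X"
  | (arc) v w where "a = 2 * v + 1" "b = 2 * w" "(v, w) \<in> E"
  | (star) "a = 2 * n" "b = 2 * n + 1 \<or> b = 2 * n + 2 \<or> b = 2 * n + 3"
  using assms by (auto simp: split_digraph_def)

lemma finite_parcs_split_digraph: "finite E \<Longrightarrow> finite (parcs (split_digraph n E X))"
proof -
  assume "finite E"
  have "parcs (split_digraph n E X) \<subseteq> (\<lambda>v. (2 * v, 2 * v + 1)) ` {..<n}
      \<union> (\<lambda>(v, w). (2 * v + 1, 2 * w)) ` E \<union> (\<lambda>i. (2 * n, 2 * n + i)) ` {1, 2, 3}"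
    by (auto simp: split_digraph_def)
  then show ?thesis using \<open>finite E\<close> by (auto intro: finite_subset)
qed

lemma num_arcs_split_digraph_le:
  assumes "finite E"
  shows "num_arcs (split_digraph n E X) \<le> n + card E + 3"
proof -
  let ?A = "(\<lambda>v. (2 * v, 2 * v + 1)) ` {..<n}"
  let ?B = "(\<lambda>(v, w). (2 * v + 1, 2 * w)) ` E"
  let ?C = "(\<lambda>i. (2 * n, 2 * n + i)) ` {1, 2, 3::nat}"
  have "num_arcs (split_digraph n E X) \<le> card (?A \<union> ?B \<union> ?C)"
    unfolding num_arcs_def using assms by (intro card_mono) (auto simp: split_digraph_def)
  also have "\<dots> \<le> card ?A + card ?B + card ?C"
    by (meson add_le_mono card_Un_le le_refl le_trans)
  also have "\<dots> \<le> card {..<n} + card E + card {1, 2, 3::nat}"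
    using assms by (intro add_mono card_image_le) auto
  finally show ?thesis by simp
qed

lemma degree_eq:
  "degree D v = card {e \<in> parcs D. snd e = v} + card {e \<in> parcs D. fst e = v}"
  by (simp add: degree_def in_degree_def out_degree_def in_arcs_def out_arcs_def)

lemma degree_split_digraph_le:
  assumes "E \<subseteq> {..<n} \<times> {..<n}"
    and "\<And>v. card (E `` {v}) \<le> 2" "\<And>v. card (E\<inverse> `` {v}) \<le> 2"
  shows "degree (split_digraph n E X) u \<le> 3"
proof -
  let ?D = "split_digraph n E X"
  let ?in = "{e \<in> parcs ?D. snd e = u}" and ?out = "{e \<in> parcs ?D. fst e = u}"
  have finE: "finite E" using assms(1) finite_subset by blast
  have fins: "finite (E `` {v})" "finite (E\<inverse> `` {v})" for v
    using finE by (auto intro: finite_Image simp: finite_Image)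
  have bound: "card A \<le> k" if "A \<subseteq> B" "finite B" "card B \<le> k" for A B :: "(nat \<times> nat) set" and k
    using that card_mono le_trans by blast
  \<comment> \<open>Here \<open>u\<close> is any natural number; those beyond the last leaf fall
    under \<open>leaf\<close> as well, where both arc sets are still bounded as claimed.\<close>
  consider (small_even) v where "u = 2 * v" "v < n" | (small_odd) v where "u = 2 * v + 1" "v < n"
    | (centre) "u = 2 * n" | (leaf) "u > 2 * n"
  proof -
    have "u = 2 * (u div 2) \<or> u = 2 * (u div 2) + 1" by presburger
    then show thesis using that by (metis add_lessD1 less_mult_imp_div_less linorder_neqE_nat mult.commute)
  qed
  then show ?thesis
  proof cases
    case small_even
    have "?in \<subseteq> (\<lambda>w. (2 * w + 1, u)) ` (E\<inverse> `` {v})"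
      using small_even by (auto elim!: split_digraph_arcE; presburger)
    then have "card ?in \<le> 2"
      using assms(3)[of v] card_image_le[OF fins(2)] by (elim bound) (auto simp: fins intro: le_trans)
    moreover have "?out \<subseteq> {(u, u + 1)}"
      using small_even by (auto elim!: split_digraph_arcE; presburger)
    then have "card ?out \<le> 1" by (rule bound) auto
    ultimately show ?thesis unfolding degree_eq by linarith
  next
    case small_odd
    have "?out \<subseteq> (\<lambda>w. (u, 2 * w)) ` (E `` {v})"
      using small_odd by (auto elim!: split_digraph_arcE; presburger)
    then have "card ?out \<le> 2"
      using assms(2)[of v] card_image_le[OF fins(1)] by (elim bound) (auto simp: fins intro: le_trans)
    moreover have "?in \<subseteq> {(u - 1, u)}"
      using small_odd by (auto elim!: split_digraph_arcE; presburger)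
    then have "card ?in \<le> 1" by (rule bound) auto
    ultimately show ?thesis unfolding degree_eq by linarith
  next
    case centre
    have "?in \<subseteq> {}"
      using centre assms(1) by (auto elim!: split_digraph_arcE; presburger)
    then have "card ?in \<le> 0" by (rule bound) auto
    moreover have "?out \<subseteq> {(u, u + 1), (u, u + 2), (u, u + 3)}"
      using centre assms(1) by (auto elim!: split_digraph_arcE; presburger)
    then have "card ?out \<le> 3" by (rule bound) auto
    ultimately show ?thesis unfolding degree_eq by linarith
  next
    case leaf
    have "?out \<subseteq> {}"
      using leaf assms(1) by (auto elim!: split_digraph_arcE)
    then have "card ?out \<le> 0" by (rule bound) auto
    moreover have "?in \<subseteq> {(2 * n, u)}"
      using leaf assms(1) by (auto elim!: split_digraph_arcE)
    then have "card ?in \<le> 1" by (rule bound) auto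
    ultimately show ?thesis unfolding degree_eq by linarith
  qed
qed

lemma max_degree_split_digraph:
  assumes "E \<subseteq> {..<n} \<times> {..<n}"
    and "\<And>v. card (E `` {v}) \<le> 2" "\<And>v. card (E\<inverse> `` {v}) \<le> 2"
  shows "max_degree (split_digraph n E X) = 3"
proof -
  let ?D = "split_digraph n E X"
  have "finite E" using assms(1) finite_subset by blast
  then have "card {(2 * n, 2 * n + 1), (2 * n, 2 * n + 2), (2 * n, 2 * n + 3)}
      \<le> card {e \<in> parcs ?D. fst e = 2 * n}"
    using finite_parcs_split_digraph by (intro card_mono) (auto simp: split_digraph_def)
  then have "3 \<le> degree ?D (2 * n)" unfolding degree_eq by simp
  then have "degree ?D (2 * n) = 3" using degree_split_digraph_le[OF assms, of X "2 * n"] by simp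
  then show ?thesis
    unfolding max_degree_def using degree_split_digraph_le[OF assms]
    by (intro Max_eqI) (auto simp: split_digraph_def image_iff intro!: bexI[of _ "2 * n"])
qed

text \<open>A directed 2-cycle could only run between \<open>2 * v\<close> and
  \<open>2 * v + 1\<close>; it would come from a loop of \<open>E\<close> at \<open>v\<close>, but
  then \<open>v\<close> lies in \<open>X\<close> and its vertex arc is deleted.\<close>

lemma oriented_graph_split_digraph:
  assumes "E \<subseteq> {..<n} \<times> {..<n}" "\<And>v. (v, v) \<in> E \<Longrightarrow> v \<in> X"
  shows "oriented_graph (split_digraph n E X)"
proof -
  let ?D = "split_digraph n E X"
  have "finite E" using assms(1) finite_subset by blast
  then have "finite (parcs ?D)" by (rule finite_parcs_split_digraph)
  moreover have "fst e \<in> pverts ?D \<and> snd e \<in> pverts ?D \<and> fst e \<noteq> snd e" if "e \<in> parcs ?D" for e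
    using that assms(1) by (auto simp: split_digraph_def; presburger)
  moreover have "(v, u) \<notin> parcs ?D" if "(u, v) \<in> parcs ?D" for u v
  proof
    assume r: "(v, u) \<in> parcs ?D"
    show False using that
    proof (cases rule: split_digraph_arcE)
      case (vertex x)
      then show False using r assms by (auto elim!: split_digraph_arcE; presburger)
    next
      case (arc x y)
      then show False using r assms by (auto elim!: split_digraph_arcE; presburger)
    next
      case star
      then show False using r assms by (auto elim!: split_digraph_arcE; presburger)
    qed
  qed
  moreover have "finite (pverts ?D)" by (simp add: split_digraph_def)
  ultimately show ?thesis by unfold_locales auto
qed

text \<open>A walk from an odd vertex alternates between arcs of \<open>E\<close> and vertex arcs.
  An odd vertex is entered by a vertex arc, so the head of the preceding arc is outside
  \<open>X\<close>; at an even end this is not yet known for the last arc, whence the two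
  cases.\<close>

lemma split_digraph_relpow_from_odd:
  assumes "E \<subseteq> {..<n} \<times> {..<n}"
    and "(u, z) \<in> parcs (split_digraph n E X) ^^ L" "odd u"
  defines "H \<equiv> E \<inter> UNIV \<times> (- X)"
  shows "(odd z \<longrightarrow> (\<exists>k\<le>L. (0 < L \<longrightarrow> 0 < k) \<and> (u div 2, z div 2) \<in> H ^^ k)) \<and>
    (even z \<longrightarrow> (\<exists>k<L. \<exists>w. (u div 2, w) \<in> H ^^ k \<and> (w, z div 2) \<in> E))"
  using assms(2)
proof (induction L arbitrary: z)
  case 0
  then show ?case using assms(3) by auto
next
  case (Suc L)
  then obtain y where y: "(u, y) \<in> parcs (split_digraph n E X) ^^ L"
    "(y, z) \<in> parcs (split_digraph n E X)" by auto
  note IH = Suc.IH[OF y(1)]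
  show ?case using y(2)
  proof (cases rule: split_digraph_arcE)
    case (vertex v)
    then obtain k w where "k < L" "(u div 2, w) \<in> H ^^ k" "(w, v) \<in> E" using IH by auto
    then have "(u div 2, v) \<in> H ^^ Suc k" "Suc k \<le> Suc L"
      using vertex by (auto simp: H_def)
    then show ?thesis using vertex by (auto intro!: exI[of _ "Suc k"])
  next
    case (arc v w)
    then obtain k where "k \<le> L" "(u div 2, v) \<in> H ^^ k" using IH by auto
    then have "k < Suc L" "(u div 2, v) \<in> H ^^ k" "(v, z div 2) \<in> E" using arc by auto
    then show ?thesis using arc by auto
  next
    \<comment> \<open>The walk never reaches the centre \<open>2 * n\<close>, because no arc of
      \<open>E\<close> ends in \<open>n\<close>.\<close>
    case star
    then show ?thesis using IH assms(1) by auto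
  qed
qed

text \<open>A closed walk can be rotated by one arc so that it starts at an odd vertex, unless its
  first arc belongs to the star, whose leaves are sinks.\<close>

lemma split_digraph_closed_walk:
  assumes "E \<subseteq> {..<n} \<times> {..<n}"
    and "(u, u) \<in> parcs (split_digraph n E X) ^^ L" "0 < L"
  shows "\<exists>k v. 0 < k \<and> k \<le> L \<and> (v, v) \<in> (E \<inter> UNIV \<times> (- X)) ^^ k"
proof -
  let ?r = "parcs (split_digraph n E X)"
  have odd_case: ?thesis if "(y, y) \<in> ?r ^^ L" "odd y" for y
    using split_digraph_relpow_from_odd[OF assms(1) that] that(2) assms(3) by blast
  obtain L' where L': "L = Suc L'" using assms(3) gr0_conv_Suc by auto
  then obtain y where y: "(u, y) \<in> ?r" "(y, u) \<in> ?r ^^ L'"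
    using assms(2) relpow_Suc_D2 by metis
  show ?thesis using y(1)
  proof (cases rule: split_digraph_arcE)
    case (vertex v)
    have "(y, y) \<in> ?r ^^ L" using y L' by auto
    then show ?thesis using odd_case vertex by auto
  next
    case (arc v w)
    then show ?thesis using odd_case[OF assms(2)] by auto
  next
    case star
    have "(y, z) \<notin> ?r" for z
      using star assms(1) by (auto elim!: split_digraph_arcE)
    moreover have "y \<noteq> u" using star by auto
    ultimately show ?thesis using y(2) by (cases L') (auto simp del: relpow.simps(2) dest: relpow_Suc_D2)
  qed
qed

text \<open>Charge each arc of \<open>F\<close> to the original vertex at its tail. Together with
  \<open>X\<close> these vertices form a feedback vertex set of \<open>E\<close>, because a cycle of
  \<open>E\<close> avoiding them lifts to one avoiding \<open>F\<close>.\<close>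

lemma card_feedback_arc_set_split_digraph:
  assumes "E \<subseteq> {..<n} \<times> {..<n}" "\<And>v. (v, v) \<in> E \<Longrightarrow> v \<in> X" "finite X"
    and F: "feedback_arc_set (split_digraph n E X) F"
    and S: "\<And>S. finite S \<Longrightarrow> card S \<le> t \<Longrightarrow> \<not> acyclic (E \<inter> (- S) \<times> (- S))"
  shows "t < card F + card X"
proof (rule ccontr)
  assume le: "\<not> t < card F + card X"
  let ?D = "split_digraph n E X"
  let ?D' = "?D\<lparr>parcs := parcs ?D - F\<rparr>"
  interpret oriented_graph ?D using assms by (intro oriented_graph_split_digraph)
  have finF: "finite F" using F pair_finite_arcs by (auto simp: feedback_arc_set_def intro: finite_subset)
  define S where "S = X \<union> (\<lambda>e. fst e div 2) ` F"
  have finS: "finite S" using assms(3) finF by (simp add: S_def)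
  have "card S \<le> card X + card F"
    unfolding S_def using card_Un_le card_image_le[OF finF] by (meson add_le_mono le_refl le_trans)
  then have "\<not> acyclic (E \<inter> (- S) \<times> (- S))" using le S[OF finS] by simp
  then obtain v where v: "(v, v) \<in> (E \<inter> (- S) \<times> (- S))\<^sup>+" by (auto simp: acyclic_def)
  have step: "(2 * v + 1, 2 * w + 1) \<in> (parcs ?D')\<^sup>+" if "(v, w) \<in> E \<inter> (- S) \<times> (- S)" for v w
  proof -
    \<comment> \<open>Neither arc is in \<open>F\<close>: their tails are charged to
      \<open>v\<close> and \<open>w\<close>, both outside \<open>S\<close>. The second arc exists
      since \<open>w\<close> is not in \<open>X\<close>.\<close>
    have "(2 * v + 1, 2 * w) \<in> parcs ?D'" "(2 * w, 2 * w + 1) \<in> parcs ?D'"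
      using that assms(1) by (force simp: split_digraph_def S_def)+
    then show ?thesis by (meson trancl.intros)
  qed
  have "(2 * v + 1, 2 * w + 1) \<in> (parcs ?D')\<^sup>+" if "(v, w) \<in> (E \<inter> (- S) \<times> (- S))\<^sup>+" for v w
    using that by (induction rule: trancl_induct) (blast intro: step trancl_trans)+
  then have "\<not> acyclic (parcs ?D')" using v by (auto simp: acyclic_def)
  moreover have "pair_wf_digraph ?D'"
    using arc_fst_in_verts arc_snd_in_verts by unfold_locales auto
  ultimately show False
    using F acyclic_parcs[of ?D'] by (simp add: feedback_arc_set_def)
qed

section \<open>Cutting a topological order\<close>

text \<open>Builds a final segment of a topological order of \<open>U\<close>, one vertex at a
  time.\<close>

lemma acyclic_closed_subset_of_card:
  assumes "finite r" "acyclic r" "finite U" "m \<le> card U"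
  shows "\<exists>B \<subseteq> U. card B = m \<and> (\<forall>x y. (x, y) \<in> r \<longrightarrow> x \<in> B \<longrightarrow> y \<in> U \<longrightarrow> y \<in> B)"
  using assms(4)
proof (induction m)
  case (Suc m)
  then obtain B where B: "B \<subseteq> U" "card B = m"
    "\<And>x y. (x, y) \<in> r \<Longrightarrow> x \<in> B \<Longrightarrow> y \<in> U \<Longrightarrow> y \<in> B" by auto
  have "U - B \<noteq> {}" using B Suc.prems by auto
  \<comment> \<open>Minimality for the converse relation: all successors of \<open>x\<close> within
    \<open>U\<close> are already in \<open>B\<close>.\<close>
  then obtain x where x: "x \<in> U - B" "\<And>y. (y, x) \<in> r\<inverse> \<Longrightarrow> y \<notin> U - B"
    by (rule wfE_min'[OF finite_acyclic_wf_converse[OF assms(1,2)]]) blast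
  have "finite B" using B(1) assms(3) finite_subset by blast
  then have "card (insert x B) = Suc m" using x(1) B(2) by simp
  then show ?case using B x by (intro exI[of _ "insert x B"]) auto
qed auto

text \<open>As a relation it merges parallel arcs, which can only lower degrees and the number of
  arcs.\<close>

definition slot_arcs :: "(nat \<Rightarrow> nat) \<Rightarrow> nat set \<Rightarrow> nat rel" where
  "slot_arcs s T = (\<lambda>x. (x div 2, s x div 2)) ` T"

lemma not_acyclic_slot_arcs:
  assumes "s permutes {..<50 * t}" "\<not> splittable t s" "finite S" "card S \<le> t"
  shows "\<not> acyclic (slot_arcs s {..<50 * t} \<inter> (- S) \<times> (- S))"
proof
  let ?r = "slot_arcs s {..<50 * t} \<inter> (- S) \<times> (- S)"
  assume ac: "acyclic ?r"
  have "card {..<25 * t} - card S \<le> card ({..<25 * t} - S)"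
    by (rule diff_card_le_card_Diff[OF assms(3)])
  then have "24 * t \<le> card ({..<25 * t} - S)" using assms(4) by simp
  then obtain U where U: "U \<subseteq> {..<25 * t} - S" "card U = 24 * t" "finite U"
    using obtain_subset_with_card_n by metis
  have "finite ?r" by (simp add: slot_arcs_def)
  then obtain B where B: "B \<subseteq> U" "card B = 12 * t"
    "\<And>x y. (x, y) \<in> ?r \<Longrightarrow> x \<in> B \<Longrightarrow> y \<in> U \<Longrightarrow> y \<in> B"
    using acyclic_closed_subset_of_card[OF _ ac U(3), of "12 * t"] U(2) by auto
  have "card (U - B) = 12 * t"
    using B(1,2) U(2,3) by (simp add: card_Diff_subset finite_subset)
  moreover have "no_slot_arcs s B (U - B)"
    unfolding no_slot_arcs_def
  proof (intro allI impI notI)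
    fix x assume x: "x div 2 \<in> B" "s x div 2 \<in> U - B"
    have "x div 2 < 25 * t" using x(1) B(1) U(1) by auto
    then have "x \<in> {..<50 * t}" by auto
    then have "(x div 2, s x div 2) \<in> ?r" using x B(1) U(1) by (auto simp: slot_arcs_def)
    then show False using B(3) x by blast
  qed
  ultimately have "splittable t s"
    unfolding splittable_def using B(1,2) U(1) by (intro exI[of _ "U - B"] exI[of _ B]) auto
  then show False using assms(2) by simp
qed

section \<open>Destroying the short closed walks\<close>

text \<open>Take a shortest closed walk over all starting vertices; a repeated vertex would cut off
  a shorter one.\<close>

lemma minimal_closed_walk:
  assumes "(v, v) \<in> H ^^ k" "0 < k"
  obtains l f where "0 < l" "l \<le> k" "f l = f 0" "inj_on f {..<l}"
    "\<And>i. i < l \<Longrightarrow> (f i, f (Suc i)) \<in> H"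
proof -
  define l where "l = (LEAST l. 0 < l \<and> (\<exists>v. (v, v) \<in> H ^^ l))"
  have l: "0 < l \<and> (\<exists>v. (v, v) \<in> H ^^ l)"
    unfolding l_def by (rule LeastI[of _ k]) (use assms in auto)
  have least: "l \<le> m" if "0 < m" "(v, v) \<in> H ^^ m" for m v
    unfolding l_def by (rule Least_le) (use that in auto)
  obtain f where f: "f l = f 0" "\<And>i. i < l \<Longrightarrow> (f i, f (Suc i)) \<in> H"
    using l by (auto simp: relpow_fun_conv)
  have "f i \<noteq> f j" if "i < j" "j < l" for i j
  proof
    assume eq: "f i = f j"
    have "(f i, f j) \<in> H ^^ (j - i)"
      unfolding relpow_fun_conv using that f(2) by (intro exI[of _ "\<lambda>k. f (i + k)"]) auto
    then show False using least[of "j - i" "f i"] eq that by auto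
  qed
  then have "inj_on f {..<l}" by (auto simp: inj_on_def) (metis linorder_neqE_nat)
  then show ?thesis using that l f least[of k v] assms by auto
qed

text \<open>The slots along a shortest closed walk form a short slot cycle, so its first vertex lies
  in \<open>X\<close>. That vertex is also the head of the last arc, and heads avoid
  \<open>X\<close>.\<close>

lemma slot_arcs_no_short_closed_walk:
  fixes s :: "nat \<Rightarrow> nat" and T :: "nat set"
  assumes "0 < k" "k < g"
  defines "X \<equiv> (\<lambda>xs. hd xs div 2) ` short_slot_cycles g T s"
  shows "(v, v) \<notin> (slot_arcs s T \<inter> UNIV \<times> (- X)) ^^ k"
proof
  assume "(v, v) \<in> (slot_arcs s T \<inter> UNIV \<times> (- X)) ^^ k"
  then obtain l f where l: "0 < l" "l \<le> k" and f: "f l = f 0" "inj_on f {..<l}"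
    "\<And>i. i < l \<Longrightarrow> (f i, f (Suc i)) \<in> slot_arcs s T \<inter> UNIV \<times> (- X)"
    by (rule minimal_closed_walk[OF _ assms(1)]) blast
  have "\<forall>i. \<exists>x. i < l \<longrightarrow> x \<in> T \<and> x div 2 = f i \<and> s x div 2 = f (Suc i)"
    using f(3) by (fastforce simp: slot_arcs_def)
  then obtain x where x: "\<And>i. i < l \<Longrightarrow> x i \<in> T \<and> x i div 2 = f i \<and> s (x i) div 2 = f (Suc i)"
    by metis
  define xs where "xs = map x [0..<l]"
  have "distinct xs"
    unfolding xs_def distinct_map
  proof (intro conjI inj_onI)
    fix i j assume ij: "i \<in> set [0..<l]" "j \<in> set [0..<l]" "x i = x j"
    then have "f i = f j" using x[of i] x[of j] by simp
    then show "i = j" using f(2) ij by (auto dest: inj_onD)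
  qed simp
  moreover have "map (\<lambda>x. s x div 2) xs = rotate1 (map (\<lambda>x. x div 2) xs)"
  proof (rule nth_equalityI)
    fix i assume "i < length (map (\<lambda>x. s x div 2) xs)"
    then have i: "i < l" by (simp add: xs_def)
    \<comment> \<open>Rotation by one reads position \<open>Suc i mod l\<close>; the wrap-around at
      the last index is \<open>f l = f 0\<close>.\<close>
    have "Suc i mod l < l" using l by simp
    then have "f (Suc i mod l) = f (Suc i)"
      using i f(1) by (cases "Suc i = l") auto
    then show "map (\<lambda>x. s x div 2) xs ! i = rotate1 (map (\<lambda>x. x div 2) xs) ! i"
      using i x[OF i] x[OF \<open>Suc i mod l < l\<close>] by (simp add: xs_def nth_rotate1)
  qed simp
  ultimately have "xs \<in> short_slot_cycles g T s"
    using x l assms(2) by (auto simp: short_slot_cycles_def slot_cycle_def xs_def)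
  moreover have "hd xs div 2 = f 0" using l x[of 0] by (simp add: xs_def hd_map)
  ultimately have "f 0 \<in> X" unfolding X_def by force
  moreover have "f l \<notin> X" using f(3)[of "l - 1"] l by simp
  ultimately show False using f(1) by simp
qed

lemma card_slot_arcs_Image_le:
  assumes "s permutes T"
  shows "card (slot_arcs s T `` {v}) \<le> 2" "card ((slot_arcs s T)\<inverse> `` {v}) \<le> 2"
proof -
  have div2: "x = 2 * (x div 2) \<or> x = 2 * (x div 2) + 1" for x :: nat by presburger
  have le2: "card A \<le> 2" if "A \<subseteq> f ` {2 * v, 2 * v + 1}" for A :: "nat set" and f :: "nat \<Rightarrow> nat"
  proof -
    have "card A \<le> card (f ` {2 * v, 2 * v + 1})" using that by (intro card_mono) auto
    also have "\<dots> \<le> card {2 * v, 2 * v + 1}" by (rule card_image_le) simp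
    finally show ?thesis by simp
  qed
  show "card (slot_arcs s T `` {v}) \<le> 2"
  proof (rule le2, rule subsetI)
    fix w assume "w \<in> slot_arcs s T `` {v}"
    then obtain x where "x div 2 = v" "w = s x div 2" by (auto simp: slot_arcs_def)
    then show "w \<in> (\<lambda>x. s x div 2) ` {2 * v, 2 * v + 1}" using div2[of x] by auto
  qed
  show "card ((slot_arcs s T)\<inverse> `` {v}) \<le> 2"
  proof (rule le2, rule subsetI)
    fix w assume "w \<in> (slot_arcs s T)\<inverse> `` {v}"
    then obtain x where x: "s x div 2 = v" "w = x div 2" by (auto simp: slot_arcs_def)
    have "inv s (s x) = x" using permutes_inverses(2)[OF assms] by simp
    then have "w = inv s (s x) div 2" using x by simp
    then show "w \<in> (\<lambda>y. inv s y div 2) ` {2 * v, 2 * v + 1}" using div2[of "s x"] x(1) by auto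
  qed
qed

section \<open>Choice of parameters and assembly\<close>

lemma exists_cubic_oriented_graph:
  assumes "g \<ge> 3"
  obtains D :: "nat pair_pre_digraph" where "oriented_graph D" "max_degree D = 3"
    "num_arcs D < 95 * fas D" "directed_girth D \<ge> enat g" "parcs D \<noteq> {}"
proof -
  define M :: nat where "M = 2 * (\<Sum>l<g. 4 ^ l)"
  \<comment> \<open>With at most \<open>75 * t + 3\<close> arcs and \<open>fas\<close> at least
    \<open>t + 1 - M\<close>, the factor 95 needs \<open>19 * M \<le> 4 * t\<close>, which
    \<open>5 * M\<close> provides. The summand \<open>g\<close> gives \<open>t > 0\<close> and
    \<open>g \<le> 25 * t\<close>.\<close>
  define t where "t = 5 * M + g"
  have t: "t > 0" "g \<le> 25 * t" using assms by (auto simp: t_def)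
  obtain s where s: "s permutes {..<50 * t}" "\<not> splittable t s"
    "card (short_slot_cycles g {..<50 * t} s) \<le> M"
    using exists_unsplittable_few_short_cycles[OF t] unfolding M_def by blast
  define n where "n = 25 * t"
  define E where "E = slot_arcs s {..<50 * t}"
  \<comment> \<open>The empty slot cycle contributes the unspecified vertex
    \<open>hd [] div 2\<close>; this is harmless, as \<open>card X\<close> is still at most the
    number of lists.\<close>
  define X where "X = (\<lambda>xs. hd xs div 2) ` short_slot_cycles g {..<50 * t} s"
  let ?D = "split_digraph n E X"
  have finC: "finite (short_slot_cycles g {..<50 * t} s)" by (simp add: finite_short_slot_cycles)
  have finX: "finite X" unfolding X_def using finC by simp
  have cX: "card X \<le> M" unfolding X_def using card_image_le[OF finC] s(3) le_trans by blast
  have E: "E \<subseteq> {..<n} \<times> {..<n}"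
  proof -
    have "s x < 50 * t" if "x < 50 * t" for x
      using permutes_in_image[OF s(1), of x] that by simp
    then show ?thesis by (auto simp: E_def slot_arcs_def n_def less_mult_imp_div_less)
  qed
  have finE: "finite E" by (simp add: E_def slot_arcs_def)
  have cE: "card E \<le> 50 * t"
    unfolding E_def slot_arcs_def using card_image_le[of "{..<50 * t}"] by fastforce
  have short: "(v, v) \<notin> (E \<inter> UNIV \<times> (- X)) ^^ k" if "0 < k" "k < g" for k v
    using slot_arcs_no_short_closed_walk[OF that] by (simp add: E_def X_def)
  \<comment> \<open>A loop outside \<open>X\<close> would be a closed walk of length 1.\<close>
  have loops: "v \<in> X" if "(v, v) \<in> E" for v
    using short[of 1 v] that assms by auto
  have deg: "card (E `` {v}) \<le> 2" "card (E\<inverse> `` {v}) \<le> 2" for v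
    unfolding E_def by (rule card_slot_arcs_Image_le[OF s(1)])+
  have "oriented_graph ?D" by (rule oriented_graph_split_digraph[OF E loops])
  moreover have "max_degree ?D = 3" by (rule max_degree_split_digraph[OF E deg])
  moreover have "directed_girth ?D \<ge> enat g"
    using split_digraph_closed_walk[OF E] short by (intro directed_girth_ge) (meson le_less_trans)
  moreover have "parcs ?D \<noteq> {}" by (auto simp: split_digraph_def)
  moreover have "num_arcs ?D < 95 * fas ?D"
  proof -
    obtain F where F: "feedback_arc_set ?D F" "card F = fas ?D"
      using fas_attained[OF finite_parcs_split_digraph[OF finE]] by blast
    have "t < card F + card X"
      by (rule card_feedback_arc_set_split_digraph[OF E loops finX F(1)])
         (use not_acyclic_slot_arcs[OF s(1,2)] in \<open>simp_all add: E_def\<close>)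
    then have "t + 1 \<le> fas ?D + M" using F(2) cX by simp
    moreover have "num_arcs ?D \<le> 75 * t + 3"
      using num_arcs_split_digraph_le[OF finE, of n X] cE by (simp add: n_def)
    moreover have "19 * M \<le> 4 * t" unfolding t_def by simp
    ultimately show ?thesis by linarith
  qed
  ultimately show ?thesis using that by blast
qed

theorem theorem7:
  fixes g :: nat
  assumes "g \<ge> 3"
  shows "(\<exists>D :: nat pair_pre_digraph. oriented_graph D \<and> max_degree D = 3 \<and>
            real (fas D) > real (num_arcs D) / 95 \<and> directed_girth D \<ge> enat g) \<and>
         fas_sup 3 g > 1 / 95 \<and>
         fasd_min 3 g \<le> 94"
proof -
  obtain D :: "nat pair_pre_digraph" where D: "oriented_graph D" "max_degree D = 3"
    "num_arcs D < 95 * fas D" "directed_girth D \<ge> enat g" "parcs D \<noteq> {}"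
    using exists_cubic_oriented_graph[OF assms] by blast
  have fin: "finite (parcs D')" if "oriented_graph D'" for D' :: "nat pair_pre_digraph"
  proof -
    interpret oriented_graph D' by fact
    show ?thesis by (rule pair_finite_arcs)
  qed
  have mem: "D \<in> bounded_oriented_graphs 3 g"
    using D by (simp add: bounded_oriented_graphs_def)
  have ratio: "real (fas D) > real (num_arcs D) / 95" using D(3) by simp
  have pos: "num_arcs D > 0" using D(5) fin[OF D(1)] by (simp add: num_arcs_def card_gt_0_iff)
  have "1 / 95 < real (fas D) / real (num_arcs D)"
    using ratio pos by (simp add: field_simps)
  also have "\<dots> \<le> fas_sup 3 g"
    unfolding fas_sup_def
  \<comment> \<open>A real supremum bounds its members only if the set is bounded above; all ratios
    are at most 1 because the set of all arcs is a feedback arc set.\<close>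
  proof (rule cSUP_upper[OF mem], rule bdd_aboveI2)
    fix D' assume "D' \<in> bounded_oriented_graphs 3 g"
    then have "fas D' \<le> num_arcs D'"
      using fin fas_le_num_arcs by (auto simp: bounded_oriented_graphs_def)
    then show "real (fas D') / real (num_arcs D') \<le> 1" by (simp add: divide_le_eq)
  qed
  finally have "1 / 95 < fas_sup 3 g" .
  moreover have "fasd_min 3 g \<le> 94"
  proof -
    have "fasd_min 3 g \<le> fasd D" unfolding fasd_min_def by (rule INF_lower[OF mem])
    \<comment> \<open>Here 95 is \<open>Suc 94\<close>: 95 disjoint feedback arc sets would need
      more arcs than \<open>D\<close> has.\<close>
    also have "\<dots> \<le> enat 94" using fin[OF D(1)] D(3) by (intro fasd_le) auto
    finally show ?thesis by (simp add: numeral_eq_enat)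
  qed
  ultimately show ?thesis using D ratio by blast
qed

end
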